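(* Let $n\ge 0$ be an integer, let $\Omega\subset\mathbb{C}$ be a domain, and let $f_0,\dots,f_n$ be holomorphic functions on $\Omega$ that are linearly independent over $\mathbb{C}$. Then there is a discrete subset $\mathcal{E}$ of $\Omega$ with the following property: whenever $g=\sum_{j=0}^n\lambda_jf_j$ is a nontrivial linear combination of $f_0,\dots,f_n$ (that is, $\lambda_0,\dots,\lambda_n\in\mathbb{C}$ are not all zero), every zero of $g$ in $\Omega$ whose multiplicity exceeds $n$ belongs to $\mathcal{E}$.
   Context: A domain is a nonempty connected open subset of $\mathbb{C}$. A subset $\mathcal{E}\subset\Omega$ is called discrete if it has no accumulation points in $\Omega$. The set $\mathcal{E}$ may depend on $f_0,\dots,f_n$ but not on the coefficients $\lambda_0,\dots,\lambda_n$. *)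

theory Defs
  imports "HOL-Complex_Analysis.Complex_Analysis"
begin

(* Linear independence over the complex numbers of the family f 0, ..., f n of functions
   with domain S. Only the values on S matter, since HOL functions are total; and it is a
   statement about the family, not about the set {f 0, ..., f n}, so repetitions are excluded. *)
definition lin_indep_funs_on :: "complex set \<Rightarrow> nat \<Rightarrow> (nat \<Rightarrow> complex \<Rightarrow> complex) \<Rightarrow> bool" where
  "lin_indep_funs_on S n f \<longleftrightarrow>
     (\<forall>c :: nat \<Rightarrow> complex. (\<forall>z\<in>S. (\<Sum>j\<le>n. c j * f j z) = 0) \<longrightarrow> (\<forall>j\<le>n. c j = 0))"

(* The subset E of \<Omega> has no accumulation point in \<Omega>. The library's "discrete" is strictly
   weaker: it excludes only accumulation points that belong to E itself. *)
definition discrete_subset_of :: "complex set \<Rightarrow> complex set \<Rightarrow> bool" where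
  "discrete_subset_of E \<Omega> \<longleftrightarrow> E \<subseteq> \<Omega> \<and> (\<forall>z\<in>\<Omega>. \<not> z islimpt E)"

end

theory Submission
  imports Defs
begin

text \<open>
  The classical choice for the exceptional set is the zero set of the Wronskian determinant of
  the family: a combination vanishing at \<open>z\<close> to order greater than \<open>n\<close> gives a nontrivial kernel
  vector of the Wronskian matrix at \<open>z\<close>. The proof below reaches the same kind of set by reduction
  of order, which needs only Wronskians of two functions and no determinants.

  Write \<open>W(a, g) = a g' - g a'\<close> and take the last function \<open>a\<close> of a family of length \<open>n + 2\<close> as a
  pivot; by linear independence it is not identically zero. The map \<open>W(a, -)\<close> is linear, kills
  \<open>a\<close>, and its kernel on the domain consists only of the constant multiples of \<open>a\<close> (\<open>wronskian2_zero_imp_multiple\<close>), because \<open>W(a, g) / a^2\<close> is the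
  derivative of \<open>g / a\<close>. Hence the \<open>n + 1\<close> functions obtained from the other members of the family
  are again linearly independent (\<open>lin_indep_reduce_order\<close>). Moreover \<open>W(a, -)\<close> lowers the order
  of vanishing at a point by at most one (\<open>vanishes_to_order_wronskian2\<close>). So wherever a
  combination of the original family vanishes to order \<open>n + 2\<close>, the combination of the reduced
  family with the same coefficients vanishes to order \<open>n + 1\<close>, and induction applies unless these
  coefficients are all zero. In that case the combination is a nonzero multiple of \<open>a\<close>, and the
  point is one of the zeros of \<open>a\<close>, which have no accumulation point in the domain.
\<close>

section \<open>Order of vanishing\<close>

text \<open>
  Unlike \<^const>\<open>zorder\<close>, this notion is meaningful for the zero function as well and says
  ``at least \<open>m\<close>'', so it can be transported through algebraic operations without case distinctions.
\<close>

definition vanishes_to_order :: "nat \<Rightarrow> (complex \<Rightarrow> complex) \<Rightarrow> complex \<Rightarrow> bool" where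
  "vanishes_to_order m g z \<longleftrightarrow>
     (\<exists>h. h analytic_on {z} \<and> (\<forall>\<^sub>F w in nhds z. g w = (w - z) ^ m * h w))"

lemma vanishes_to_order_cong:
  assumes "vanishes_to_order m g z" "\<forall>\<^sub>F w in nhds z. g w = g' w"
  shows "vanishes_to_order m g' z"
proof -
  obtain h where h: "h analytic_on {z}" "\<forall>\<^sub>F w in nhds z. g w = (w - z) ^ m * h w"
    using assms(1) unfolding vanishes_to_order_def by blast
  from h(2) assms(2) have "\<forall>\<^sub>F w in nhds z. g' w = (w - z) ^ m * h w"
    by eventually_elim simp
  with h(1) show ?thesis
    unfolding vanishes_to_order_def by blast
qed

lemma vanishes_to_order_Suc_imp_zero:
  assumes "vanishes_to_order (Suc m) g z"
  shows "g z = 0"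
  using assms eventually_nhds_x_imp_x unfolding vanishes_to_order_def by fastforce

text \<open>
  A function that is nonzero somewhere on a connected open set cannot vanish identically near \<open>z\<close>,
  by the identity theorem; this excludes the case in which the value of \<^const>\<open>zorder\<close> carries no information.
\<close>

lemma zorder_imp_vanishes_to_order:
  assumes "g holomorphic_on S" "open S" "connected S" "z \<in> S" "\<exists>w\<in>S. g w \<noteq> 0"
    and "int m \<le> zorder g z"
  shows "vanishes_to_order m g z"
proof -
  define k where "k = nat (zorder g z)"
  obtain r where r: "r > 0" "zor_poly g z holomorphic_on cball z r"
      "\<forall>w\<in>cball z r. g w = zor_poly g z w * (w - z) ^ k"
    using zorder_exist_zero[OF assms(1-5)] unfolding k_def by blast
  define h where "h w = (w - z) ^ (k - m) * zor_poly g z w" for w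
  have "m \<le> k"
    using assms(6) unfolding k_def by simp
  hence split: "(w - z) ^ k = (w - z) ^ m * (w - z) ^ (k - m)" for w
    by (metis le_add_diff_inverse power_add)
  have "zor_poly g z holomorphic_on ball z r"
    using r(2) by (rule holomorphic_on_subset) auto
  hence "h holomorphic_on ball z r"
    unfolding h_def by (intro holomorphic_intros)
  hence "h analytic_on {z}"
    using r(1) by (meson analytic_at centre_in_ball open_ball)
  moreover have "\<forall>\<^sub>F w in nhds z. w \<in> ball z r"
    using r(1) by (intro eventually_nhds_in_open) auto
  hence "\<forall>\<^sub>F w in nhds z. g w = (w - z) ^ m * h w"
    by eventually_elim (use r(3) split in \<open>auto simp: h_def\<close>)
  ultimately show ?thesis
    unfolding vanishes_to_order_def by blast
qed

section \<open>The Wronskian of two functions\<close>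

definition wronskian2 :: "(complex \<Rightarrow> complex) \<Rightarrow> (complex \<Rightarrow> complex) \<Rightarrow> complex \<Rightarrow> complex" where
  "wronskian2 a g z = a z * deriv g z - g z * deriv a z"

lemma wronskian2_holomorphic_on:
  assumes "a holomorphic_on S" "g holomorphic_on S" "open S"
  shows "wronskian2 a g holomorphic_on S"
  unfolding wronskian2_def using assms by (intro holomorphic_intros) auto

lemma wronskian2_sum_right:
  assumes "\<And>j. j \<in> J \<Longrightarrow> f j field_differentiable at z"
  shows "wronskian2 a (\<lambda>w. \<Sum>j\<in>J. c j * f j w) z = (\<Sum>j\<in>J. c j * wronskian2 a (f j) z)"
proof -
  have "((\<lambda>w. \<Sum>j\<in>J. c j * f j w) has_field_derivative (\<Sum>j\<in>J. c j * deriv (f j) z)) (at z)"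
    using assms by (intro DERIV_sum DERIV_cmult) (simp add: field_differentiable_derivI)
  hence "deriv (\<lambda>w. \<Sum>j\<in>J. c j * f j w) z = (\<Sum>j\<in>J. c j * deriv (f j) z)"
    by (rule DERIV_imp_deriv)
  thus ?thesis
    by (simp add: wronskian2_def sum_distrib_left sum_distrib_right sum_subtractf algebra_simps)
qed

text \<open>
  If \<open>g w = (w - z) ^ (m + 1) * h w\<close>, the derivative of \<open>g\<close> still contains the factor
  \<open>(w - z) ^ m\<close>, and hence so does the Wronskian.
\<close>

lemma vanishes_to_order_wronskian2:
  assumes "a analytic_on {z}" "vanishes_to_order (Suc m) g z"
  shows "vanishes_to_order m (wronskian2 a g) z"
proof -
  obtain h where h: "h analytic_on {z}" "\<forall>\<^sub>F w in nhds z. g w = (w - z) ^ Suc m * h w"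
    using assms(2) unfolding vanishes_to_order_def by blast
  define k where
    "k w = a w * (of_nat (Suc m) * h w + (w - z) * deriv h w) - (w - z) * h w * deriv a w" for w
  have "k analytic_on {z}"
    unfolding k_def using h(1) assms(1) by (intro analytic_intros) auto
  moreover have "\<forall>\<^sub>F w in nhds z. wronskian2 a g w = (w - z) ^ m * k w"
  proof -
    have "\<forall>\<^sub>F w in nhds z. \<forall>\<^sub>F v in nhds w. g v = (v - z) ^ Suc m * h v"
      using h(2) by (simp add: eventually_eventually)
    moreover obtain U where U: "open U" "z \<in> U" "h holomorphic_on U"
      using h(1) unfolding analytic_at by blast
    hence "\<forall>\<^sub>F w in nhds z. w \<in> U"
      by (intro eventually_nhds_in_open)
    ultimately show ?thesis
    proof eventually_elim
      case (elim w)
      have "(h has_field_derivative deriv h w) (at w)"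
        using U(1,3) elim(2) by (intro holomorphic_derivI)
      moreover have "((\<lambda>v. (v - z) ^ Suc m) has_field_derivative of_nat (Suc m) * (w - z) ^ m) (at w)"
        by (rule DERIV_cong[OF DERIV_power_Suc[OF DERIV_diff[OF DERIV_ident DERIV_const]]]) simp
      ultimately have "((\<lambda>v. (v - z) ^ Suc m * h v) has_field_derivative
              of_nat (Suc m) * (w - z) ^ m * h w + (w - z) ^ Suc m * deriv h w) (at w)"
        by (intro DERIV_cong[OF DERIV_mult]) (auto simp: algebra_simps)
      moreover have "deriv g w = deriv (\<lambda>v. (v - z) ^ Suc m * h v) w"
        using elim(1) by (rule deriv_cong_ev) simp
      ultimately have "deriv g w = of_nat (Suc m) * (w - z) ^ m * h w + (w - z) ^ Suc m * deriv h w"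
        by (simp add: DERIV_imp_deriv)
      moreover have "g w = (w - z) ^ Suc m * h w"
        using elim(1) by (rule eventually_nhds_x_imp_x)
      ultimately show ?case
        unfolding wronskian2_def k_def by (simp only:) (simp add: algebra_simps)
    qed
  qed
  ultimately show ?thesis
    unfolding vanishes_to_order_def by blast
qed

text \<open>
  The quotient \<open>g / a\<close> has derivative zero on a disc where \<open>a\<close> has no zeros, so it is constant
  there. The identity theorem spreads the resulting relation to all of the domain, which avoids
  discussing whether the complement of the zeros of \<open>a\<close> is connected.
\<close>

lemma wronskian2_zero_imp_multiple:
  assumes "open S" "connected S" "a holomorphic_on S" "g holomorphic_on S"
    and "\<exists>z\<in>S. a z \<noteq> 0" "\<And>z. z \<in> S \<Longrightarrow> wronskian2 a g z = 0"
  shows "\<exists>k. \<forall>z\<in>S. g z = k * a z"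
proof -
  obtain p where p: "p \<in> S" "a p \<noteq> 0"
    using assms(5) by blast
  have "open (S \<inter> a -` (- {0}))"
    using assms(1,3) by (intro continuous_open_preimage holomorphic_on_imp_continuous_on) auto
  then obtain r where r: "r > 0" "ball p r \<subseteq> S \<inter> a -` (- {0})"
    using p by (metis ComplI IntI open_contains_ball singletonD vimageI)
  have "((\<lambda>w. g w / a w) has_field_derivative 0) (at z)" if z: "z \<in> ball p r" for z
  proof -
    have zS: "z \<in> S" "a z \<noteq> 0"
      using z r(2) by auto
    have "((\<lambda>w. g w / a w) has_field_derivative
           (deriv g z * a z - g z * deriv a z) / (a z * a z)) (at z)"
      using assms(1,3,4) zS by (intro DERIV_divide holomorphic_derivI) auto
    moreover have "deriv g z * a z - g z * deriv a z = 0"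
      using assms(6)[OF zS(1)] by (simp add: wronskian2_def algebra_simps)
    ultimately show ?thesis
      by simp
  qed
  hence "(\<lambda>w. g w / a w) constant_on ball p r"
    by (intro has_field_derivative_0_imp_constant_on) auto
  then obtain k where "\<And>z. z \<in> ball p r \<Longrightarrow> g z / a z = k"
    unfolding constant_on_def by blast
  hence k: "g z = k * a z" if "z \<in> ball p r" for z
    using r(2) that by (fastforce simp: field_simps)
  have "g z = k * a z" if "z \<in> S" for z
    by (rule analytic_continuation_open[where s = "ball p r" and s' = S])
       (use assms r k that in \<open>auto intro!: holomorphic_intros\<close>)
  thus ?thesis
    by blast
qed

section \<open>Linearly independent families and their exceptional sets\<close>

lemma lin_indep_funs_on_nontrivial:
  assumes "lin_indep_funs_on S n f" "\<exists>j\<le>n. c j \<noteq> 0"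
  shows "\<exists>z\<in>S. (\<Sum>j\<le>n. c j * f j z) \<noteq> 0"
  using assms unfolding lin_indep_funs_on_def by blast

lemma lin_indep_funs_on_member_nonzero:
  assumes "lin_indep_funs_on S n f" "k \<le> n"
  shows "\<exists>z\<in>S. f k z \<noteq> 0"
proof -
  have "(\<Sum>j\<le>n. of_bool (j = k) * f j z) = f k z" for z
    using assms(2) by (simp add: of_bool_def if_distrib[of "\<lambda>x. x * _"] cong: if_cong)
  thus ?thesis
    using lin_indep_funs_on_nontrivial[OF assms(1), of "\<lambda>j. of_bool (j = k)"] assms(2) by auto
qed

text \<open>
  A relation between the reduced functions says that a combination of \<open>f 0, \<dots>, f n\<close> has zero
  Wronskian with \<open>f (Suc n)\<close>, hence is a multiple of it: a relation within the original family.
\<close>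

lemma lin_indep_reduce_order:
  assumes "open S" "connected S" "\<And>j. j \<le> Suc n \<Longrightarrow> f j holomorphic_on S"
    and "lin_indep_funs_on S (Suc n) f"
  shows "lin_indep_funs_on S n (\<lambda>j. wronskian2 (f (Suc n)) (f j))"
  unfolding lin_indep_funs_on_def
proof (rule allI, rule impI)
  fix c :: "nat \<Rightarrow> complex"
  assume c: "\<forall>z\<in>S. (\<Sum>j\<le>n. c j * wronskian2 (f (Suc n)) (f j) z) = 0"
  define g where "g = (\<lambda>w. \<Sum>j\<le>n. c j * f j w)"
  have "wronskian2 (f (Suc n)) g z = 0" if "z \<in> S" for z
    unfolding g_def using assms(1,3) c that
    by (subst wronskian2_sum_right) (auto intro!: holomorphic_on_imp_differentiable_at)
  moreover have "g holomorphic_on S"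
    unfolding g_def using assms(3) by (intro holomorphic_intros) auto
  ultimately obtain k where k: "\<forall>z\<in>S. g z = k * f (Suc n) z"
    using wronskian2_zero_imp_multiple[OF assms(1,2,3), of "Suc n" g]
      lin_indep_funs_on_member_nonzero[OF assms(4), of "Suc n"] by auto
  define d where "d = c(Suc n := - k)"
  have "(\<Sum>j\<le>Suc n. d j * f j z) = g z - k * f (Suc n) z" for z
    by (simp add: d_def g_def)
  hence "\<forall>j\<le>Suc n. d j = 0"
    using k assms(4) unfolding lin_indep_funs_on_def by simp
  thus "\<forall>j\<le>n. c j = 0"
    by (metis d_def fun_upd_apply le_SucI not_less_eq_eq order_refl)
qed

lemma discrete_subset_of_Un:
  "discrete_subset_of A S \<Longrightarrow> discrete_subset_of B S \<Longrightarrow> discrete_subset_of (A \<union> B) S"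
  by (auto simp: discrete_subset_of_def islimpt_Un)

lemma discrete_subset_of_zeros:
  assumes "g holomorphic_on S" "open S" "connected S" "\<exists>z\<in>S. g z \<noteq> 0"
  shows "discrete_subset_of {z\<in>S. g z = 0} S"
  unfolding discrete_subset_of_def
  using analytic_continuation[OF assms(1-3), of "{z\<in>S. g z = 0}"] assms(4) by blast

text \<open>
  The set produced by the induction is the union of the zero sets of the successive pivots. These
  are computed from the family alone, which is why one set serves all coefficient vectors.
\<close>

lemma exceptional_set_exists:
  assumes "open S" "connected S" "\<And>j. j \<le> n \<Longrightarrow> f j holomorphic_on S"
    and "lin_indep_funs_on S n f"
  shows "\<exists>E. discrete_subset_of E S \<and>
    (\<forall>c. (\<exists>j\<le>n. c j \<noteq> 0) \<longrightarrow>
      (\<forall>z\<in>S. vanishes_to_order (Suc n) (\<lambda>w. \<Sum>j\<le>n. c j * f j w) z \<longrightarrow> z \<in> E))"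
  using assms(3,4)
proof (induction n arbitrary: f)
  case 0
  have "discrete_subset_of {z\<in>S. f 0 z = 0} S"
    using assms(1,2) 0(1) lin_indep_funs_on_member_nonzero[OF 0(2)]
    by (intro discrete_subset_of_zeros) auto
  thus ?case
    by (intro exI[of _ "{z\<in>S. f 0 z = 0}"]) (auto dest!: vanishes_to_order_Suc_imp_zero)
next
  case (Suc n)
  define a where "a = f (Suc n)"
  define h where "h j = wronskian2 a (f j)" for j
  have hol_a: "a holomorphic_on S"
    using Suc.prems(1) by (simp add: a_def)
  have "lin_indep_funs_on S n h"
    using lin_indep_reduce_order[OF assms(1,2) Suc.prems] by (simp add: h_def[abs_def] a_def)
  moreover have "h j holomorphic_on S" if "j \<le> n" for j
    using that wronskian2_holomorphic_on hol_a Suc.prems(1) assms(1) by (simp add: h_def)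
  ultimately obtain E where E: "discrete_subset_of E S"
    "\<And>c z. \<exists>j\<le>n. c j \<noteq> 0 \<Longrightarrow> z \<in> S \<Longrightarrow>
       vanishes_to_order (Suc n) (\<lambda>w. \<Sum>j\<le>n. c j * h j w) z \<Longrightarrow> z \<in> E"
    using Suc.IH[of h] by blast
  define Z where "Z = {z\<in>S. a z = 0}"
  have Z: "discrete_subset_of Z S"
    unfolding Z_def using hol_a assms(1,2) lin_indep_funs_on_member_nonzero[OF Suc.prems(2)]
    by (intro discrete_subset_of_zeros) (auto simp: a_def)
  have "z \<in> Z \<union> E"
    if c: "\<exists>j\<le>Suc n. c j \<noteq> 0" and z: "z \<in> S"
      and van: "vanishes_to_order (Suc (Suc n)) (\<lambda>w. \<Sum>j\<le>Suc n. c j * f j w) z" for c z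
  proof (cases "\<exists>j\<le>n. c j \<noteq> 0")
    case True
    have "wronskian2 a (\<lambda>w. \<Sum>j\<le>Suc n. c j * f j w) w = (\<Sum>j\<le>n. c j * h j w)" if "w \<in> S" for w
    proof -
      have "wronskian2 a (\<lambda>w. \<Sum>j\<le>Suc n. c j * f j w) w = (\<Sum>j\<le>Suc n. c j * h j w)"
        unfolding h_def using Suc.prems(1) assms(1) that
        by (intro wronskian2_sum_right) (auto intro!: holomorphic_on_imp_differentiable_at)
      \<comment> \<open>The pivot has zero Wronskian with itself, so its term drops out.\<close>
      also have "h (Suc n) w = 0"
        by (simp add: h_def a_def wronskian2_def)
      hence "(\<Sum>j\<le>Suc n. c j * h j w) = (\<Sum>j\<le>n. c j * h j w)"
        by simp
      finally show ?thesis .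
    qed
    moreover have "\<forall>\<^sub>F w in nhds z. w \<in> S"
      using assms(1) z by (rule eventually_nhds_in_open)
    ultimately have ev: "\<forall>\<^sub>F w in nhds z.
        wronskian2 a (\<lambda>w. \<Sum>j\<le>Suc n. c j * f j w) w = (\<Sum>j\<le>n. c j * h j w)"
      by (auto elim: eventually_mono)
    have "a analytic_on {z}"
      using hol_a assms(1) z by (auto simp: analytic_at)
    hence "vanishes_to_order (Suc n) (\<lambda>w. \<Sum>j\<le>n. c j * h j w) z"
      using van ev by (blast intro: vanishes_to_order_cong vanishes_to_order_wronskian2)
    thus ?thesis
      using E(2) True z by blast
  next
    case False
    hence "c (Suc n) \<noteq> 0" "(\<Sum>j\<le>Suc n. c j * f j z) = c (Suc n) * a z"
      using c by (auto simp: a_def le_Suc_eq)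
    thus ?thesis
      using vanishes_to_order_Suc_imp_zero[OF van] z by (simp add: Z_def)
  qed
  thus ?case
    using discrete_subset_of_Un[OF Z E(1)] by blast
qed

theorem theoremA:
  fixes n :: nat and \<Omega> :: "complex set" and f :: "nat \<Rightarrow> complex \<Rightarrow> complex"
  assumes "open \<Omega>" and "connected \<Omega>" and "\<Omega> \<noteq> {}"
    and "\<And>j. j \<le> n \<Longrightarrow> f j holomorphic_on \<Omega>"
    and "lin_indep_funs_on \<Omega> n f"
  shows "\<exists>E. discrete_subset_of E \<Omega> \<and>
    (\<forall>c :: nat \<Rightarrow> complex. (\<exists>j\<le>n. c j \<noteq> 0) \<longrightarrow>
      (\<forall>z\<in>\<Omega>. (\<Sum>j\<le>n. c j * f j z) = 0 \<and>
               zorder (\<lambda>w. \<Sum>j\<le>n. c j * f j w) z > int n \<longrightarrow> z \<in> E))"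
proof -
  obtain E where E: "discrete_subset_of E \<Omega>"
    "\<And>c z. \<exists>j\<le>n. c j \<noteq> 0 \<Longrightarrow> z \<in> \<Omega> \<Longrightarrow>
       vanishes_to_order (Suc n) (\<lambda>w. \<Sum>j\<le>n. c j * f j w) z \<Longrightarrow> z \<in> E"
    using exceptional_set_exists[OF assms(1,2,4,5)] by blast
  have "z \<in> E" if c: "\<exists>j\<le>n. c j \<noteq> 0" and z: "z \<in> \<Omega>"
    and ord: "zorder (\<lambda>w. \<Sum>j\<le>n. c j * f j w) z > int n" for c z
  proof -
    have "(\<lambda>w. \<Sum>j\<le>n. c j * f j w) holomorphic_on \<Omega>"
      using assms(4) by (intro holomorphic_intros) auto
    hence "vanishes_to_order (Suc n) (\<lambda>w. \<Sum>j\<le>n. c j * f j w) z"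
      using assms(1,2) z ord lin_indep_funs_on_nontrivial[OF assms(5) c]
      by (intro zorder_imp_vanishes_to_order[where S = \<Omega>]) auto
    thus ?thesis
      using E(2) c z by blast
  qed
  thus ?thesis
    using E(1) by blast
qed

end
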